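(* Let $G$ be a loopless non-bipartite multigraph with maximum degree $\Delta(G)$ and odd girth $g_0(G)$, and let $d\ge 1$ be an odd integer. Then \[ \chi'_d(G)\le\left\lceil\frac{g_0(G)\,\Delta(G)-1}{d\,g_0(G)-1}\right\rceil . \]
   Context: Multigraphs are finite; parallel edges are allowed, loops are not. $\Delta(G)$ is the maximum degree of $G$, where degrees count edges with multiplicity. The underlying simple graph of $G$ is obtained by replacing each set of parallel edges by a single edge; cycles of odd length in $G$ have length at least $3$. If $G$ contains an odd cycle (equivalently, is non-bipartite), its odd girth $g_0(G)$ is the length of a shortest odd cycle. For a positive integer $d$, a $d$-defective edge coloring of $G$ is an assignment of colors to the edges of $G$ such that, for each color, the subgraph formed by the edges of that color has maximum degree at most $d$. The $d$-defective chromatic index $\chi'_d(G)$ is the least $k$ such that $G$ has a $d$-defective edge coloring using at most $k$ colors. *)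

theory Defs
  imports Complex_Main
begin

text \<open>
  Edges are abstract objects, each with a set of two distinct ends. Parallel edges are distinct
  edges with the same ends; loops are excluded by \<open>card (ends G e) = 2\<close>.
\<close>

record ('v, 'e) pre_multigraph =
  verts :: "'v set"
  edges :: "'e set"
  ends :: "'e \<Rightarrow> 'v set"

locale multigraph =
  fixes G :: "('v, 'e) pre_multigraph"
  assumes finite_verts: "finite (verts G)"
    and finite_edges: "finite (edges G)"
    and ends_subset: "e \<in> edges G \<Longrightarrow> ends G e \<subseteq> verts G"
    and card_ends: "e \<in> edges G \<Longrightarrow> card (ends G e) = 2"

definition degree :: "('v, 'e) pre_multigraph \<Rightarrow> 'v \<Rightarrow> nat" where
  "degree G v = card {e \<in> edges G. v \<in> ends G e}"

text \<open>The element 0 only matters for the graph without vertices, whose maximum degree is 0.\<close>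

definition max_degree :: "('v, 'e) pre_multigraph \<Rightarrow> nat" where
  "max_degree G = Max (insert 0 (degree G ` verts G))"

definition bipartite :: "('v, 'e) pre_multigraph \<Rightarrow> bool" where
  "bipartite G \<longleftrightarrow> (\<exists>X Y. X \<union> Y = verts G \<and> X \<inter> Y = {} \<and>
     (\<forall>e \<in> edges G. \<exists>x \<in> X. \<exists>y \<in> Y. ends G e = {x, y}))"

text \<open>
  The \<open>i\<close>-th edge joins the \<open>i\<close>-th vertex to its cyclic successor. Two parallel edges form a cycle
  of length 2, so a cycle of odd length has length at least 3.
\<close>

definition is_cycle :: "('v, 'e) pre_multigraph \<Rightarrow> 'v list \<Rightarrow> 'e list \<Rightarrow> bool" where
  "is_cycle G vs es \<longleftrightarrow>
     2 \<le> length es \<and> length vs = length es \<and> distinct vs \<and> distinct es \<and>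
     set vs \<subseteq> verts G \<and> set es \<subseteq> edges G \<and>
     (\<forall>i < length es. ends G (es ! i) = {vs ! i, vs ! (Suc i mod length es)})"

text \<open>Meaningful only if \<open>G\<close> has an odd cycle, i.e. is not bipartite.\<close>

definition odd_girth :: "('v, 'e) pre_multigraph \<Rightarrow> nat" where
  "odd_girth G = (LEAST n. odd n \<and> (\<exists>vs es. is_cycle G vs es \<and> length es = n))"

definition color_class :: "('v, 'e) pre_multigraph \<Rightarrow> ('e \<Rightarrow> 'c) \<Rightarrow> 'c \<Rightarrow> ('v, 'e) pre_multigraph" where
  "color_class G c k = G\<lparr>edges := {e \<in> edges G. c e = k}\<rparr>"

definition defective_edge_coloring ::
    "nat \<Rightarrow> ('v, 'e) pre_multigraph \<Rightarrow> ('e \<Rightarrow> 'c) \<Rightarrow> bool" where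
  "defective_edge_coloring d G c \<longleftrightarrow> (\<forall>k. max_degree (color_class G c k) \<le> d)"

text \<open>As \<open>G\<close> is finite, natural numbers supply enough colors.\<close>

definition defective_chromatic_index :: "nat \<Rightarrow> ('v, 'e) pre_multigraph \<Rightarrow> nat" where
  "defective_chromatic_index d G =
     (LEAST k. \<exists>c :: 'e \<Rightarrow> nat. defective_edge_coloring d G c \<and> card (c ` edges G) \<le> k)"

text \<open>For \<open>d \<ge> 1\<close> the minimum is over a nonempty set: give all edges different colors.\<close>

lemma (in multigraph) ex_defective_edge_coloring:
  assumes "d \<ge> 1"
  shows "\<exists>c :: 'e \<Rightarrow> nat. defective_edge_coloring d G c"
proof -
  obtain c :: "'e \<Rightarrow> nat" where c: "inj_on c (edges G)"
    using finite_imp_inj_to_nat_seg[OF finite_edges] by blast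
  have "degree (color_class G c k) v \<le> d" for k v
  proof -
    have "card {e \<in> edges (color_class G c k). v \<in> ends (color_class G c k) e} \<le> Suc 0"
      using c finite_edges by (auto simp: color_class_def card_le_Suc0_iff_eq inj_on_def)
    then show ?thesis
      using assms by (simp add: degree_def)
  qed
  then have "defective_edge_coloring d G c"
    using finite_verts by (simp add: defective_edge_coloring_def max_degree_def color_class_def)
  then show ?thesis by blast
qed

end

theory Submission
  imports Defs
begin

text \<open>
  Colors are assigned edge by edge, with \<open>k\<close> colors satisfying \<open>g (k d - D) \<ge> k - 1\<close>. Suppose that \<open>f\<close>
  cannot be colored, and let \<open>\<alpha>\<close> and \<open>\<beta>\<close> be deficient (of degree below \<open>d\<close>) at its two ends. Splitting
  the edges of the \<open>\<alpha>\<beta>\<close>-component \<open>C\<close> containing \<open>f\<close> as evenly as possible at every vertex would color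
  \<open>f\<close>, unless \<open>C\<close> is \<open>2d\<close>-regular and contains an odd cycle, so that \<open>C\<close> has at least \<open>g\<close> vertices.
  In that case any edge of \<open>C\<close> can play the role of \<open>f\<close>, and each of the \<open>k - 2\<close> other colors has
  total deficiency at most 1 on \<open>C\<close>: if a color were deficient at two vertices, Kempe swaps would
  bring the two together along a walk in \<open>C\<close>. But each vertex has total deficiency at least \<open>k d - D\<close>
  in these colors, which gives at least \<open>g (k d - D) > k - 2\<close> on \<open>C\<close>.
\<close>

section \<open>Degrees, connectivity and signed degree sums in edge sets\<close>

definition deg_in :: "('v, 'e) pre_multigraph \<Rightarrow> 'e set \<Rightarrow> 'v \<Rightarrow> nat" where
  "deg_in G F v = card {e \<in> F. v \<in> ends G e}"

definition joined :: "('v, 'e) pre_multigraph \<Rightarrow> 'e set \<Rightarrow> 'v \<Rightarrow> 'v \<Rightarrow> bool" where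
  "joined G F u v \<longleftrightarrow> (\<exists>e \<in> F. ends G e = {u, v})"

abbreviation reach :: "('v, 'e) pre_multigraph \<Rightarrow> 'e set \<Rightarrow> 'v \<Rightarrow> 'v \<Rightarrow> bool" where
  "reach G F \<equiv> (joined G F)\<^sup>*\<^sup>*"

text \<open>For signs \<open>c\<close> with values 1 and -1 this is the discrepancy at
  \<open>v\<close> of the split of \<open>F\<close> into the edges of sign 1 and the others. As an
  integer sum it is additive over edges, and negating \<open>c\<close> exchanges the two
  halves.\<close>

definition excess :: "('v, 'e) pre_multigraph \<Rightarrow> 'e set \<Rightarrow> ('e \<Rightarrow> int) \<Rightarrow> 'v \<Rightarrow> int" where
  "excess G F c v = (\<Sum>e \<in> {e \<in> F. v \<in> ends G e}. c e)"

lemma joined_sym: "joined G F u v \<Longrightarrow> joined G F v u"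
  by (auto simp: joined_def insert_commute)

lemma reach_sym: "reach G F u v \<Longrightarrow> reach G F v u"
  by (metis joined_sym sympI symp_rtranclp sympD)

lemma deg_in_mono: "finite F' \<Longrightarrow> {e \<in> F. v \<in> ends G e} \<subseteq> F' \<Longrightarrow> deg_in G F v \<le> deg_in G F' v"
  unfolding deg_in_def by (rule card_mono) auto

lemma deg_in_Un:
  "finite F \<Longrightarrow> finite F' \<Longrightarrow> F \<inter> F' = {} \<Longrightarrow> deg_in G (F \<union> F') v = deg_in G F v + deg_in G F' v"
  unfolding deg_in_def by (subst card_Un_disjoint[symmetric]) (auto intro!: arg_cong[where f = card])

lemma deg_in_insert:
  assumes "finite F" "f \<notin> F"
  shows "deg_in G (insert f F) v = deg_in G F v + (if v \<in> ends G f then 1 else 0)"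
proof -
  have "{e \<in> insert f F. v \<in> ends G e}
      = (if v \<in> ends G f then insert f {e \<in> F. v \<in> ends G e} else {e \<in> F. v \<in> ends G e})"
    by auto
  then show ?thesis
    using assms by (simp add: deg_in_def)
qed

lemma sum_deg_in_classes:
  assumes "finite F" "finite A" "\<And>e. e \<in> F \<Longrightarrow> \<phi> e \<in> A"
  shows "(\<Sum>\<gamma>\<in>A. deg_in G {e \<in> F. \<phi> e = \<gamma>} v) = deg_in G F v"
proof -
  have "(\<Sum>\<gamma>\<in>A. sum (\<lambda>_. 1::nat) {x \<in> {e \<in> F. v \<in> ends G e}. \<phi> x = \<gamma>}) = sum (\<lambda>_. 1) {e \<in> F. v \<in> ends G e}"
    by (rule sum.group) (use assms in auto)
  moreover have "{x \<in> {e \<in> F. v \<in> ends G e}. \<phi> x = \<gamma>} = {e \<in> {e \<in> F. \<phi> e = \<gamma>}. v \<in> ends G e}" for \<gamma>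
    by auto
  ultimately show ?thesis
    by (simp add: deg_in_def)
qed

lemma excess_cong:
  "(\<And>e. e \<in> F \<Longrightarrow> v \<in> ends G e \<Longrightarrow> c e = c' e) \<Longrightarrow> excess G F c v = excess G F c' v"
  unfolding excess_def by (rule sum.cong) auto

lemma excess_uminus: "excess G F (\<lambda>e. - c e) v = - excess G F c v"
  by (simp add: excess_def sum_negf)

lemma excess_remove:
  assumes "finite F" "f \<in> F"
  shows "excess G F c v = excess G (F - {f}) c v + (if v \<in> ends G f then c f else 0)"
proof -
  have "{e \<in> F. v \<in> ends G e} = (if v \<in> ends G f then insert f {e \<in> F - {f}. v \<in> ends G e} else {e \<in> F - {f}. v \<in> ends G e})"
    using assms by auto
  then show ?thesis
    using assms by (simp add: excess_def)
qed

lemma excess_eq_diff: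
  assumes "finite F" "\<And>e. c e = 1 \<or> c e = (-1::int)"
  shows "int (deg_in G F v) = int (deg_in G {e \<in> F. c e = 1} v) + int (deg_in G {e \<in> F. c e \<noteq> 1} v)"
    and "excess G F c v = int (deg_in G {e \<in> F. c e = 1} v) - int (deg_in G {e \<in> F. c e \<noteq> 1} v)"
proof -
  have F: "{e \<in> F. c e = 1} \<union> {e \<in> F. c e \<noteq> 1} = F"
    by auto
  then show "int (deg_in G F v) = int (deg_in G {e \<in> F. c e = 1} v) + int (deg_in G {e \<in> F. c e \<noteq> 1} v)"
    using deg_in_Un[of "{e \<in> F. c e = 1}" "{e \<in> F. c e \<noteq> 1}" G v] assms(1) by fastforce
  let ?P = "{e \<in> {e \<in> F. c e = 1}. v \<in> ends G e}" and ?N = "{e \<in> {e \<in> F. c e \<noteq> 1}. v \<in> ends G e}"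
  have "excess G F c v = sum c (?P \<union> ?N)"
    unfolding excess_def by (rule sum.cong) auto
  also have "\<dots> = sum c ?P + sum c ?N"
    by (rule sum.union_disjoint) (use assms(1) in auto)
  also have "sum c ?P = (\<Sum>e\<in>?P. 1)"
    by (rule sum.cong) auto
  also have "sum c ?N = (\<Sum>e\<in>?N. -1)"
    by (rule sum.cong) (use assms(2) in auto)
  finally show "excess G F c v = int (deg_in G {e \<in> F. c e = 1} v) - int (deg_in G {e \<in> F. c e \<noteq> 1} v)"
    by (simp add: deg_in_def)
qed

section \<open>Nearly balanced signs on a component\<close>

context multigraph
begin

lemma obtain_ends:
  assumes "e \<in> edges G" "u \<in> ends G e"
  obtains w where "ends G e = {u, w}" "u \<noteq> w"
proof -
  obtain a b where "ends G e = {a, b}" "a \<noteq> b"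
    using card_ends[OF assms(1)] by (meson card_2_iff)
  then show ?thesis
    using assms(2) that[of a] that[of b] by (auto simp: insert_commute)
qed

lemma reach_closed:
  assumes "e \<in> F" "F \<subseteq> edges G" "u \<in> ends G e" "reach G F s u" "v \<in> ends G e"
  shows "reach G F s v"
proof (cases "u = v")
  case False
  then have "ends G e = {u, v}"
    using assms obtain_ends[of e u] by (metis empty_iff insert_iff subsetD)
  then have "joined G F u v"
    using assms(1) by (auto simp: joined_def)
  then show ?thesis
    using assms(4) by auto
qed (use assms in simp)

text \<open>Only the part of a walk after its last passage through \<open>f\<close> matters, and
  that part starts at an end of \<open>f\<close>.\<close>

lemma reach_remove_edge:
  assumes "reach G F u v" "ends G f = {u, w}"
  shows "reach G (F - {f}) u v \<or> reach G (F - {f}) w v"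
  using assms(1)
proof (induction rule: rtranclp_induct)
  case (step y z)
  then obtain e where e: "e \<in> F" "ends G e = {y, z}"
    by (auto simp: joined_def)
  show ?case
  proof (cases "e = f")
    case True
    then show ?thesis
      using e assms(2) by (auto simp: doubleton_eq_iff)
  next
    case False
    then have "joined G (F - {f}) y z"
      using e by (auto simp: joined_def)
    then show ?thesis
      using step.IH by (meson rtranclp.rtrancl_into_rtrancl)
  qed
qed simp

text \<open>If \<open>f\<close> is a bridge, the signs on its two sides are chosen independently; otherwise both ends
  lie in the component of \<open>w\<close>, and only \<open>w\<close> can have excess 2.\<close>

lemma balanced_signs_minus_edge:
  assumes F: "F \<subseteq> edges G" and f: "f \<in> F" "ends G f = {u, w}"
    and signs: "\<And>s. \<exists>c. (\<forall>e. c e = 1 \<or> c e = (-1::int)) \<and> \<bar>excess G (F - {f}) c s\<bar> \<le> 2 \<and>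
      (\<forall>v. reach G (F - {f}) s v \<longrightarrow> v \<noteq> s \<longrightarrow> \<bar>excess G (F - {f}) c v\<bar> \<le> 1)"
  obtains c where "\<And>e. c e = 1 \<or> c e = (-1::int)" "c f = 1"
    "excess G (F - {f}) c w \<in> {-2..0}" "excess G (F - {f}) c u \<in> {-2..1}"
    "\<And>v. reach G F u v \<Longrightarrow> v \<noteq> u \<Longrightarrow> v \<noteq> w \<Longrightarrow> \<bar>excess G (F - {f}) c v\<bar> \<le> 1"
proof -
  let ?F = "F - {f}"
  \<comment> \<open>Negating all signs if necessary makes the excess of the root nonpositive. Adding
    \<open>f\<close> with sign 1 then brings the excess of the root \<open>w\<close> between -1 and
    1.\<close>
  have nonpos: "\<exists>c. (\<forall>e. c e = 1 \<or> c e = (-1::int)) \<and> excess G ?F c s \<in> {-2..0} \<and>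
      (\<forall>v. reach G ?F s v \<longrightarrow> v \<noteq> s \<longrightarrow> \<bar>excess G ?F c v\<bar> \<le> 1)" for s
  proof -
    obtain c where c: "\<forall>e. c e = 1 \<or> c e = (-1::int)" "\<bar>excess G ?F c s\<bar> \<le> 2"
      "\<forall>v. reach G ?F s v \<longrightarrow> v \<noteq> s \<longrightarrow> \<bar>excess G ?F c v\<bar> \<le> 1"
      using signs by blast
    show ?thesis
    proof (cases "excess G ?F c s \<le> 0")
      case True
      then show ?thesis using c by (intro exI[of _ c]) auto
    next
      case False
      moreover have "- c e = 1 \<or> - c e = -1" for e
        using c(1) by (metis add.inverse_inverse)
      ultimately show ?thesis using c
        by (intro exI[of _ "\<lambda>e. - c e"]) (auto simp: excess_uminus)
    qed
  qed
  obtain c1 where c1: "\<And>e. c1 e = 1 \<or> c1 e = (-1::int)" "excess G ?F c1 w \<in> {-2..0}"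
    "\<And>v. reach G ?F w v \<Longrightarrow> v \<noteq> w \<Longrightarrow> \<bar>excess G ?F c1 v\<bar> \<le> 1"
    using nonpos[of w] by blast
  obtain c2 where c2: "\<And>e. c2 e = 1 \<or> c2 e = (-1::int)" "excess G ?F c2 u \<in> {-2..0}"
    "\<And>v. reach G ?F u v \<Longrightarrow> v \<noteq> u \<Longrightarrow> \<bar>excess G ?F c2 v\<bar> \<le> 1"
    using nonpos[of u] by blast
  have uw: "u \<noteq> w"
    using card_ends[of f] F f by auto
  \<comment> \<open>\<open>c1\<close> serves the edges that meet the component of \<open>w\<close>
    in \<open>?F\<close>, and \<open>c2\<close> all other edges of \<open>?F\<close>. No edge of
    \<open>?F\<close> leaves that component, so each vertex sees only one of the two
    signings.\<close>
  define c where "c = (\<lambda>e. if e = f then 1 else if \<exists>v\<in>ends G e. reach G ?F w v then c1 e else c2 e)"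
  have in_w: "excess G ?F c v = excess G ?F c1 v" if "reach G ?F w v" for v
    by (rule excess_cong) (use that in \<open>auto simp: c_def\<close>)
  have off_w: "excess G ?F c v = excess G ?F c2 v" if "\<not> reach G ?F w v" for v
  proof (rule excess_cong)
    fix e assume e: "e \<in> ?F" "v \<in> ends G e"
    have "\<not> reach G ?F w x" if "x \<in> ends G e" for x
      using reach_closed[OF e(1) _ that, of w v] e F \<open>\<not> reach G ?F w v\<close> by blast
    then show "c e = c2 e"
      using e by (auto simp: c_def)
  qed
  show ?thesis
  proof (rule that[of c])
    show "c e = 1 \<or> c e = -1" for e
      using c1(1) c2(1) by (auto simp: c_def)
    show "c f = 1"
      by (simp add: c_def)
    show "excess G ?F c w \<in> {-2..0}"
      using in_w[of w] c1(2) by simp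
    \<comment> \<open>If \<open>u\<close> lies in the component of \<open>w\<close>, it is not the
      root of \<open>c1\<close> and has excess between -1 and 1; otherwise it is the root of
      \<open>c2\<close>, with excess between -2 and 0.\<close>
    show "excess G ?F c u \<in> {-2..1}"
      using in_w[of u] off_w[of u] c1(3)[of u] c2(2) uw by (cases "reach G ?F w u") auto
    show "\<bar>excess G ?F c v\<bar> \<le> 1" if "reach G F u v" "v \<noteq> u" "v \<noteq> w" for v
      using in_w[of v] off_w[of v] c1(3)[of v] c2(3)[of v] that reach_remove_edge[OF that(1) f(2)]
      by (cases "reach G ?F w v") auto
  qed
qed

text \<open>Induction on the number of edges, deleting an edge \<open>f\<close> at the root
  \<open>s\<close>. With sign 1, \<open>f\<close> moves the excess of its other end between -1 and
  1, and that of \<open>s\<close> between -1 and 2. An odd cycle shows that 2 is best possible at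
  the root: its excesses are even and sum to twice an odd number.\<close>

lemma balanced_signs:
  assumes "F \<subseteq> edges G"
  shows "\<exists>c. (\<forall>e. c e = 1 \<or> c e = (-1::int)) \<and> \<bar>excess G F c s\<bar> \<le> 2 \<and>
      (\<forall>v. reach G F s v \<longrightarrow> v \<noteq> s \<longrightarrow> \<bar>excess G F c v\<bar> \<le> 1)"
  using assms
proof (induction "card F" arbitrary: F s rule: less_induct)
  case less
  have fin: "finite F"
    using less.prems finite_edges finite_subset by blast
  show ?case
  proof (cases "\<exists>f\<in>F. s \<in> ends G f")
    case False
    have "v = s" if "reach G F s v" for v
      using that False by (induction rule: rtranclp_induct) (auto simp: joined_def)
    moreover have "excess G F (\<lambda>_. 1) s = 0"
      unfolding excess_def by (rule sum.neutral) (use False in auto)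
    ultimately show ?thesis
      by (intro exI[of _ "\<lambda>_. 1"]) auto
  next
    case True
    then obtain f w where f: "f \<in> F" "ends G f = {s, w}" "s \<noteq> w"
      using obtain_ends less.prems by (metis subsetD)
    have "card (F - {f}) < card F" "F - {f} \<subseteq> edges G"
      using card_Diff1_less[OF fin f(1)] less.prems by auto
    from less.hyps[OF this] obtain c where c: "\<And>e. c e = 1 \<or> c e = (-1::int)" "c f = 1"
      "excess G (F - {f}) c w \<in> {-2..0}" "excess G (F - {f}) c s \<in> {-2..1}"
      "\<And>v. reach G F s v \<Longrightarrow> v \<noteq> s \<Longrightarrow> v \<noteq> w \<Longrightarrow> \<bar>excess G (F - {f}) c v\<bar> \<le> 1"
      by (rule balanced_signs_minus_edge[OF less.prems f(1,2)]) (rule that)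
    have "\<bar>excess G F c v\<bar> \<le> 1" if "reach G F s v" "v \<noteq> s" for v
    proof (cases "v = w")
      case True
      then show ?thesis
        using excess_remove[OF fin f(1), of G c w] c(2,3) f(2) by auto
    next
      case False
      then show ?thesis
        using excess_remove[OF fin f(1), of G c v] c(5)[OF that] f(2) that(2) by simp
    qed
    moreover have "\<bar>excess G F c s\<bar> \<le> 2"
      using excess_remove[OF fin f(1), of G c s] c(2,4) f(2) by auto
    ultimately show ?thesis
      using c(1) by blast
  qed
qed

section \<open>Paths, vertex two-colorings and odd cycles\<close>

lemma ex_path:
  assumes "reach G F u w"
  shows "\<exists>vs es. length vs = Suc (length es) \<and> distinct vs \<and> vs ! 0 = u \<and> last vs = w \<and>
    set es \<subseteq> F \<and> (\<forall>i < length es. ends G (es ! i) = {vs ! i, vs ! Suc i})"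
  using assms
proof (induction rule: converse_rtranclp_induct)
  case base
  show ?case
    by (rule exI[of _ "[w]"], rule exI[of _ "[]"]) auto
next
  case (step u x)
  then obtain vs es where p: "length vs = Suc (length es)" "distinct vs" "vs ! 0 = x" "last vs = w"
    "set es \<subseteq> F" "\<And>i. i < length es \<Longrightarrow> ends G (es ! i) = {vs ! i, vs ! Suc i}"
    by blast
  obtain e where e: "e \<in> F" "ends G e = {u, x}"
    using step.hyps(1) by (auto simp: joined_def)
  show ?case
  proof (cases "u \<in> set vs")
    \<comment> \<open>The vertex \<open>u\<close> already lies on the path from \<open>x\<close>, so
      the part of that path from \<open>u\<close> on will do.\<close>
    case True
    then obtain n where n: "n < length vs" "vs ! n = u"
      by (auto simp: in_set_conv_nth)
    have "set (drop n es) \<subseteq> F"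
      using p(5) set_drop_subset by fast
    then show ?thesis
      using p n by (intro exI[of _ "drop n vs"] exI[of _ "drop n es"]) (auto simp: last_drop)
  next
    case False
    have "ends G ((e # es) ! i) = {(u # vs) ! i, (u # vs) ! Suc i}" if "i < length (e # es)" for i
      using that p e by (cases i) auto
    then show ?thesis
      using p e False by (intro exI[of _ "u # vs"] exI[of _ "e # es"]) auto
  qed
qed

text \<open>Edges are added one by one. If the new edge \<open>f\<close> joins two components, the
  two-coloring can be flipped on one side. If its ends are already connected, colors alternate along
  a path between them: either the ends differ and the coloring survives, or the path has even length
  and closes with \<open>f\<close> to an odd cycle.\<close>

lemma two_coloring_or_odd_cycle:
  assumes "F \<subseteq> edges G"
  shows "(\<exists>s :: 'v \<Rightarrow> bool. \<forall>e\<in>F. \<forall>u w. ends G e = {u, w} \<longrightarrow> s u \<noteq> s w) \<or>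
    (\<exists>vs es. is_cycle G vs es \<and> odd (length es) \<and> set es \<subseteq> F)"
proof -
  have "finite F"
    using assms finite_edges finite_subset by blast
  then show ?thesis
    using assms
  proof (induction F rule: finite_induct)
    case (insert f F)
    show ?case
    proof (cases "\<exists>vs es. is_cycle G vs es \<and> odd (length es) \<and> set es \<subseteq> F")
      case True
      then show ?thesis by blast
    next
      case False
      have "F \<subseteq> edges G"
        using insert.prems by simp
      from insert.IH[OF this] have "\<exists>s :: 'v \<Rightarrow> bool. \<forall>e\<in>F. \<forall>u w. ends G e = {u, w} \<longrightarrow> s u \<noteq> s w"
        by (rule disjE) (assumption, rule notE[OF False])
      then obtain s :: "'v \<Rightarrow> bool" where "\<forall>e\<in>F. \<forall>u w. ends G e = {u, w} \<longrightarrow> s u \<noteq> s w"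
        by (rule exE)
      then have s: "s u \<noteq> s w" if "e \<in> F" "ends G e = {u, w}" for e u w
        using that by simp
      obtain u w where uw: "ends G f = {u, w}" "u \<noteq> w"
        using card_ends[of f] insert.prems by (auto simp: card_2_iff)
      show ?thesis
      proof (cases "reach G F u w")
        case False
        \<comment> \<open>On the component of \<open>u\<close>, and likewise on the remaining
          vertices, \<open>s'\<close> is \<open>s\<close> or its negation. It is normalized so that
          \<open>u\<close> gets \<open>False\<close> and \<open>w\<close> gets
          \<open>True\<close>.\<close>
        define s' where "s' = (\<lambda>v. if reach G F u v then s v \<longleftrightarrow> \<not> s u else s v \<longleftrightarrow> s w)"
        have proper: "s' a \<noteq> s' b" if "e \<in> insert f F" "ends G e = {a, b}" for e a b
        proof (cases "e = f")
          case True
          then show ?thesis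
            using that uw False by (auto simp: s'_def doubleton_eq_iff)
        next
          case False
          then have e: "e \<in> F"
            using that by simp
          then have "reach G F u a \<longleftrightarrow> reach G F u b"
            using reach_closed[OF e, of a u b] reach_closed[OF e, of b u a] that insert.prems by auto
          then show ?thesis
            using s[OF e that(2)] by (auto simp: s'_def)
        qed
        show ?thesis
          by (intro disjI1 exI[of _ s'] ballI allI impI proper)
      next
        case True
        then obtain vs es where p: "length vs = Suc (length es)" "distinct vs" "vs ! 0 = u" "last vs = w"
          "set es \<subseteq> F" "\<And>i. i < length es \<Longrightarrow> ends G (es ! i) = {vs ! i, vs ! Suc i}"
          using ex_path by blast
        have alternating: "i \<le> length es \<Longrightarrow> s (vs ! i) \<longleftrightarrow> (s u \<longleftrightarrow> even i)" for i
        proof (induction i)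
          case (Suc i)
          then show ?case
            using s[of "es ! i" "vs ! i" "vs ! Suc i"] p by (auto simp: Suc_le_eq subset_iff)
        qed (use p in auto)
        have last: "vs ! length es = w"
          using p by (metis diff_Suc_1 last_conv_nth length_0_conv nat.distinct(1))
        show ?thesis
        proof (cases "s u = s w")
          case True
          then have even: "even (length es)"
            using alternating[of "length es"] last by auto
          have ne: "length es \<noteq> 0"
            using last p(3) uw by metis
          have "distinct es"
            unfolding distinct_conv_nth
          proof (intro allI impI notI)
            fix i j assume ij: "i < length es" "j < length es" "i \<noteq> j" "es ! i = es ! j"
            then have "{vs ! i, vs ! Suc i} = {vs ! j, vs ! Suc j}"
              using p(6) by metis
            then show False
              using ij p(1,2) by (auto simp: doubleton_eq_iff nth_eq_iff_index_eq)
          qed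
          moreover have "f \<notin> set es"
            using p(5) insert.hyps(2) by blast
          ultimately have distinct: "distinct (es @ [f])"
            by simp
          have ends_i: "ends G ((es @ [f]) ! i) = {vs ! i, vs ! (Suc i mod length (es @ [f]))}"
            if "i < length (es @ [f])" for i
          proof (cases "i < length es")
            case True
            then show ?thesis using p by (simp add: nth_append)
          next
            case False
            then have "i = length es" using that by simp
            then show ?thesis
              using p uw last by (auto simp: nth_append)
          qed
          have edges: "set (es @ [f]) \<subseteq> edges G"
            using p(5) insert.prems by auto
          have verts: "set vs \<subseteq> verts G"
          proof
            fix v assume "v \<in> set vs"
            then obtain i where i: "i < length (es @ [f])" "vs ! i = v"
              using p(1) by (auto simp: in_set_conv_nth)
            have "(es @ [f]) ! i \<in> set (es @ [f])"
              using i(1) nth_mem by blast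
            then have "(es @ [f]) ! i \<in> edges G"
              using edges by blast
            then show "v \<in> verts G"
              using ends_subset ends_i[OF i(1)] i(2) by blast
          qed
          have "2 \<le> length (es @ [f])"
            using ne by (cases es) auto
          then have "is_cycle G vs (es @ [f])"
            unfolding is_cycle_def using p(1,2) distinct edges verts ends_i by simp
          moreover have "odd (length (es @ [f]))" "set (es @ [f]) \<subseteq> insert f F"
            using even p(5) by auto
          ultimately show ?thesis by blast
        next
          case False
          have proper: "s a \<noteq> s b" if "e \<in> insert f F" "ends G e = {a, b}" for e a b
            using that s[of e a b] uw False by (auto simp: doubleton_eq_iff)
          show ?thesis
            by (intro disjI1 exI[of _ s] ballI allI impI proper)
        qed
      qed
    qed
  qed simp
qed

end

section \<open>Turning signs into colors\<close>

lemma signs_halve: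
  assumes "finite F" "\<And>e. c e = 1 \<or> c e = (-1::int)"
    "int (deg_in G F v) + \<bar>excess G F c v\<bar> \<le> 2 * int d + 1"
  shows "deg_in G {e \<in> F. c e = 1} v \<le> d" "deg_in G {e \<in> F. c e \<noteq> 1} v \<le> d"
  \<comment> \<open>The larger half has (degree + |excess|) / 2 edges at \<open>v\<close>. This is
    at most d + 1/2, hence at most \<open>d\<close> by integrality.\<close>
  using excess_eq_diff[of F c G v] assms by auto

text \<open>Double counting: every edge contributes its sign at its unique end in \<open>P\<close>.
  Both sides of a bipartition are such sets, so their excess sums agree.\<close>

lemma sum_excess_transversal:
  assumes "finite F" "finite P" "\<And>e. e \<in> F \<Longrightarrow> card (P \<inter> ends G e) = 1"
  shows "(\<Sum>v\<in>P. excess G F c v) = sum c F"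
proof -
  have "(\<Sum>v\<in>P. excess G F c v) = (\<Sum>e\<in>F. \<Sum>v\<in>{v \<in> P. v \<in> ends G e}. c e)"
    unfolding excess_def by (rule sum.swap_restrict) (use assms in auto)
  also have "\<dots> = sum c F"
    using assms(3) by (intro sum.cong) (auto simp: Int_def)
  finally show ?thesis .
qed

text \<open>The palette is fixed and values outside \<open>F\<close> are ignored, which allows a
  coloring to be extended edge by edge.\<close>

definition defective_on ::
    "('v, 'e) pre_multigraph \<Rightarrow> nat \<Rightarrow> nat \<Rightarrow> 'e set \<Rightarrow> ('e \<Rightarrow> nat) \<Rightarrow> bool" where
  "defective_on G d k F \<phi> \<longleftrightarrow> (\<forall>e\<in>F. \<phi> e < k) \<and> (\<forall>\<gamma> v. deg_in G {e \<in> F. \<phi> e = \<gamma>} v \<le> d)"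

text \<open>At a vertex of \<open>C\<close>, only edges of \<open>K\<close> have the new colors
  \<open>\<alpha>\<close> and \<open>\<beta>\<close>, so \<open>small\<close> applies. At every
  other vertex, and in every other color, the new class is part of the old one. Old and new domains
  may differ, so that the same argument colors a new edge or exchanges the uncolored edge for
  another.\<close>

lemma defective_on_recolor:
  assumes F: "finite F" "defective_on G d k F \<phi>"
    and kept: "\<And>e. e \<in> T \<Longrightarrow> e \<notin> K \<Longrightarrow> e \<in> F \<and> \<psi> e = \<phi> e"
    and new: "\<And>e. e \<in> T \<Longrightarrow> e \<in> K \<Longrightarrow> \<psi> e \<in> {\<alpha>, \<beta>}" and "\<alpha> < k" "\<beta> < k"
    and K: "\<And>e. e \<in> T \<Longrightarrow> e \<in> K \<Longrightarrow> ends G e \<subseteq> C"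
    and separated: "\<And>e. e \<in> T \<Longrightarrow> e \<notin> K \<Longrightarrow> \<phi> e \<in> {\<alpha>, \<beta>} \<Longrightarrow> ends G e \<inter> C = {}"
    and small: "\<And>v \<gamma>. v \<in> C \<Longrightarrow> \<gamma> \<in> {\<alpha>, \<beta>} \<Longrightarrow> deg_in G {e \<in> T \<inter> K. \<psi> e = \<gamma>} v \<le> d"
  shows "defective_on G d k T \<psi>"
  unfolding defective_on_def
proof (intro conjI ballI allI)
  fix e assume "e \<in> T"
  then show "\<psi> e < k"
    using kept[of e] new[of e] F(2) \<open>\<alpha> < k\<close> \<open>\<beta> < k\<close> by (cases "e \<in> K") (auto simp: defective_on_def)
next
  fix \<gamma> v
  show "deg_in G {e \<in> T. \<psi> e = \<gamma>} v \<le> d"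
  proof (cases "v \<in> C \<and> \<gamma> \<in> {\<alpha>, \<beta>}")
    case True
    have "e \<in> K" if e: "e \<in> T" "\<psi> e = \<gamma>" "v \<in> ends G e" for e
    proof (rule ccontr)
      assume "e \<notin> K"
      then have "ends G e \<inter> C = {}"
        using separated[of e] kept[of e] e True by auto
      then show False
        using e True by auto
    qed
    then have "{e \<in> {e \<in> T. \<psi> e = \<gamma>}. v \<in> ends G e} = {e \<in> {e \<in> T \<inter> K. \<psi> e = \<gamma>}. v \<in> ends G e}"
      by auto
    then show ?thesis
      using small[of v \<gamma>] True by (simp add: deg_in_def)
  next
    case False
    have "e \<in> F \<and> \<phi> e = \<gamma>" if e: "e \<in> T" "\<psi> e = \<gamma>" "v \<in> ends G e" for e
    proof -
      have "e \<notin> K"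
        using new[of e] K[of e] e False by auto
      then show ?thesis
        using kept[of e] e by auto
    qed
    then have "deg_in G {e \<in> T. \<psi> e = \<gamma>} v \<le> deg_in G {e \<in> F. \<phi> e = \<gamma>} v"
      by (intro deg_in_mono) (use F(1) in auto)
    then show ?thesis
      using F(2) by (auto simp: defective_on_def intro: le_trans)
  qed
qed

section \<open>Two-color components in an edge set that cannot be colored\<close>

locale uncolorable = multigraph G for G :: "('v, 'e) pre_multigraph" +
  fixes F :: "'e set" and d k D g :: nat
  assumes F_edges: "F \<subseteq> edges G"
    and uncolorable: "\<not> defective_on G d k F \<phi>"
    and deg_le: "deg_in G F v \<le> D"
    and odd_cycles: "is_cycle G vs es \<Longrightarrow> odd (length es) \<Longrightarrow> g \<le> length es"
    and d_pos: "1 \<le> d"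
    and g_ge: "2 \<le> g"
    and enough_colors: "g * D + k \<le> g * (k * d) + 1"
begin

lemma finite_F: "finite F"
  using F_edges finite_edges finite_subset by blast

text \<open>The uncolored edge \<open>f\<close> always belongs to this set, whatever the value
  \<open>\<phi> f\<close>: these are the edges that \<open>\<alpha>\<close> and
  \<open>\<beta>\<close> would have to share once \<open>f\<close> is colored too.\<close>

definition two_colors :: "('e \<Rightarrow> nat) \<Rightarrow> 'e \<Rightarrow> nat \<Rightarrow> nat \<Rightarrow> 'e set" where
  "two_colors \<phi> f \<alpha> \<beta> = insert f {e \<in> F - {f}. \<phi> e = \<alpha> \<or> \<phi> e = \<beta>}"

lemma two_colors_subset: "f \<in> F \<Longrightarrow> two_colors \<phi> f \<alpha> \<beta> \<subseteq> F"
  by (auto simp: two_colors_def)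

lemma deg_two_colors:
  assumes "\<alpha> \<noteq> \<beta>"
  shows "deg_in G (two_colors \<phi> f \<alpha> \<beta>) v = deg_in G {e \<in> F - {f}. \<phi> e = \<alpha>} v
    + deg_in G {e \<in> F - {f}. \<phi> e = \<beta>} v + (if v \<in> ends G f then 1 else 0)"
proof -
  have "{e \<in> F - {f}. \<phi> e = \<alpha> \<or> \<phi> e = \<beta>} = {e \<in> F - {f}. \<phi> e = \<alpha>} \<union> {e \<in> F - {f}. \<phi> e = \<beta>}"
    by auto
  moreover have "deg_in G ({e \<in> F - {f}. \<phi> e = \<alpha>} \<union> {e \<in> F - {f}. \<phi> e = \<beta>}) v
      = deg_in G {e \<in> F - {f}. \<phi> e = \<alpha>} v + deg_in G {e \<in> F - {f}. \<phi> e = \<beta>} v"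
    by (rule deg_in_Un) (use finite_F assms in auto)
  moreover have "deg_in G (two_colors \<phi> f \<alpha> \<beta>) v
      = deg_in G {e \<in> F - {f}. \<phi> e = \<alpha> \<or> \<phi> e = \<beta>} v + (if v \<in> ends G f then 1 else 0)"
    unfolding two_colors_def by (rule deg_in_insert) (use finite_F in auto)
  ultimately show ?thesis
    by metis
qed

lemma color_with_missing:
  assumes "f \<in> F" "defective_on G d k (F - {f}) \<phi>" "ends G f = {x, y}" "\<gamma> < k"
    "deg_in G {e \<in> F - {f}. \<phi> e = \<gamma>} x < d" "deg_in G {e \<in> F - {f}. \<phi> e = \<gamma>} y < d"
  shows False
proof -
  have "deg_in G {e \<in> F. (\<phi>(f := \<gamma>)) e = \<delta>} v \<le> d" for \<delta> v
  proof (cases "\<delta> = \<gamma>")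
    case True
    then have "{e \<in> F. (\<phi>(f := \<gamma>)) e = \<delta>} = insert f {e \<in> F - {f}. \<phi> e = \<gamma>}"
      using assms(1) by auto
    then show ?thesis
      using assms finite_F by (auto simp: deg_in_insert defective_on_def)
  next
    case False
    then have "{e \<in> F. (\<phi>(f := \<gamma>)) e = \<delta>} = {e \<in> F - {f}. \<phi> e = \<delta>}"
      by auto
    then show ?thesis
      using assms(2) by (auto simp: defective_on_def)
  qed
  then have "defective_on G d k F (\<phi>(f := \<gamma>))"
    using assms(2,4) by (auto simp: defective_on_def)
  then show False
    using uncolorable by blast
qed

text \<open>On the component of \<open>x\<close> in \<open>E'\<close>, sign 1 becomes
  \<open>\<alpha>\<close> and the other sign becomes \<open>\<beta>\<close>; all other edges keep
  their colors. Taking \<open>T\<close> to be \<open>F\<close> colors \<open>f\<close> as well, and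
  taking \<open>T\<close> to be \<open>F\<close> without another edge of the component moves the gap
  there.\<close>

lemma recolor_component:
  assumes f: "f \<in> F" "x \<in> ends G f" and \<phi>: "defective_on G d k (F - {f}) \<phi>"
    and colors: "\<alpha> \<noteq> \<beta>" "\<alpha> < k" "\<beta> < k"
    and E': "E' = two_colors \<phi> f \<alpha> \<beta>"
    and T: "T \<subseteq> F"
    and small: "\<And>v. reach G E' x v \<Longrightarrow> deg_in G {e \<in> T \<inter> E'. c e = (1::int)} v \<le> d"
      "\<And>v. reach G E' x v \<Longrightarrow> deg_in G {e \<in> T \<inter> E'. c e \<noteq> 1} v \<le> d"
  obtains \<psi> where "defective_on G d k T \<psi>" "\<And>e. e \<in> T - E' \<Longrightarrow> \<psi> e = \<phi> e"
    "\<And>e. e \<in> T \<inter> E' \<Longrightarrow> \<psi> e \<in> {\<alpha>, \<beta>}"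
proof -
  have E'_edges: "E' \<subseteq> edges G"
    using two_colors_subset[OF f(1)] E' F_edges by blast
  have finT: "finite T"
    using T finite_F finite_subset by blast
  define C where "C = {v. reach G E' x v}"
  have closed: "ends G e \<subseteq> C" if "e \<in> E'" "ends G e \<inter> C \<noteq> {}" for e
    using reach_closed[OF that(1) E'_edges] that(2) by (auto simp: C_def)
  define K where "K = {e \<in> E'. ends G e \<subseteq> C}"
  have "f \<in> E'"
    by (simp add: E' two_colors_def)
  then have fK: "f \<in> K"
    using closed[of f] f(2) by (auto simp: K_def C_def)
  define \<psi> where "\<psi> = (\<lambda>e. if e \<in> K then if c e = 1 then \<alpha> else \<beta> else \<phi> e)"
  have le: "deg_in G {e \<in> T \<inter> K. \<psi> e = \<gamma>} v \<le> d" if "v \<in> C" "\<gamma> \<in> {\<alpha>, \<beta>}" for v \<gamma>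
  proof (cases "\<gamma> = \<alpha>")
    case True
    have "deg_in G {e \<in> T \<inter> K. \<psi> e = \<gamma>} v \<le> deg_in G {e \<in> T \<inter> E'. c e = 1} v"
      by (rule deg_in_mono)
        (use finT True colors in \<open>auto simp: \<psi>_def K_def split: if_splits\<close>)
    then show ?thesis
      using small(1)[of v] that by (auto simp: C_def)
  next
    case False
    have "deg_in G {e \<in> T \<inter> K. \<psi> e = \<gamma>} v \<le> deg_in G {e \<in> T \<inter> E'. c e \<noteq> 1} v"
      by (rule deg_in_mono)
        (use finT False in \<open>auto simp: \<psi>_def K_def split: if_splits\<close>)
    then show ?thesis
      using small(2)[of v] that by (auto simp: C_def)
  qed
  have "defective_on G d k T \<psi>"
  proof (rule defective_on_recolor[OF _ \<phi>, where K = K and C = C and \<alpha> = \<alpha> and \<beta> = \<beta>])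
    fix e assume e: "e \<in> T" "e \<notin> K" "\<phi> e \<in> {\<alpha>, \<beta>}"
    then have "e \<in> E'"
      using T fK by (auto simp: E' two_colors_def)
    then show "ends G e \<inter> C = {}"
      using closed[of e] e by (auto simp: K_def)
  qed (use T fK colors finite_F le in \<open>auto simp: \<psi>_def K_def\<close>)
  moreover have "\<psi> e = \<phi> e" if "e \<in> T - E'" for e
    using that by (auto simp: \<psi>_def K_def)
  moreover have "\<psi> e \<in> {\<alpha>, \<beta>}" if "e \<in> T \<inter> E'" for e
    using that fK by (auto simp: \<psi>_def E' two_colors_def)
  ultimately show ?thesis
    by (rule that)
qed

text \<open>Balanced signs rooted at a vertex of smaller degree would give an admissible recoloring with
  \<open>\<alpha>\<close> and \<open>\<beta>\<close> alone. In a regular component the sign sums over the two sides of a bipartition agree,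
  so the excess of the root vanishes and again there is a recoloring.\<close>

lemma two_color_component:
  assumes f: "f \<in> F" "ends G f = {x, y}" and \<phi>: "defective_on G d k (F - {f}) \<phi>"
    and colors: "\<alpha> \<noteq> \<beta>" "\<alpha> < k" "\<beta> < k"
    and x: "deg_in G {e \<in> F - {f}. \<phi> e = \<alpha>} x + deg_in G {e \<in> F - {f}. \<phi> e = \<beta>} x < 2 * d"
    and y: "deg_in G {e \<in> F - {f}. \<phi> e = \<alpha>} y + deg_in G {e \<in> F - {f}. \<phi> e = \<beta>} y < 2 * d"
    and E': "E' = two_colors \<phi> f \<alpha> \<beta>"
  shows "\<And>v. reach G E' x v \<Longrightarrow> deg_in G E' v = 2 * d"
    and "finite {v. reach G E' x v}" and "g \<le> card {v. reach G E' x v}"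
proof -
  have E'F: "E' \<subseteq> F"
    using two_colors_subset[OF f(1)] E' by blast
  then have E'_edges: "E' \<subseteq> edges G" and fin: "finite E'"
    using F_edges finite_F by (auto intro: finite_subset)
  \<comment> \<open>The edge \<open>f\<close> adds 1 only at \<open>x\<close> and \<open>y\<close>,
    where the two color degrees sum to less than 2d.\<close>
  have deg: "deg_in G E' v \<le> 2 * d" for v
  proof -
    have "deg_in G {e \<in> F - {f}. \<phi> e = \<alpha>} v \<le> d" "deg_in G {e \<in> F - {f}. \<phi> e = \<beta>} v \<le> d"
      using \<phi> by (auto simp: defective_on_def)
    then show ?thesis
      unfolding E' deg_two_colors[OF colors(1)] using x y f(2) by auto
  qed
  have unbalanced: "\<exists>v. reach G E' x v \<and> 2 * int d + 1 < int (deg_in G E' v) + \<bar>excess G E' c v\<bar>"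
    if c: "\<And>e. c e = 1 \<or> c e = (-1::int)" for c
  proof (rule ccontr)
    assume "\<not> ?thesis"
    then have le: "int (deg_in G E' v) + \<bar>excess G E' c v\<bar> \<le> 2 * int d + 1" if "reach G E' x v" for v
      using that by force
    have "F \<inter> E' = E'"
      using E'F by blast
    then have halves: "deg_in G {e \<in> F \<inter> E'. c e = 1} v \<le> d" "deg_in G {e \<in> F \<inter> E'. c e \<noteq> 1} v \<le> d"
      if "reach G E' x v" for v
      using signs_halve[OF fin c le[OF that]] by auto
    have x_end: "x \<in> ends G f"
      using f(2) by simp
    show False
      by (rule recolor_component[OF f(1) x_end \<phi> colors E' subset_refl halves])
        (assumption+, erule notE[OF uncolorable])
  qed
  show regular: "deg_in G E' s = 2 * d" if s: "reach G E' x s" for s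
  proof (rule ccontr)
    assume "deg_in G E' s \<noteq> 2 * d"
    then have lt: "deg_in G E' s < 2 * d"
      using deg[of s] by simp
    \<comment> \<open>Signs rooted at \<open>s\<close> are harmless: the total is at most (2d - 1) +
      2 at \<open>s\<close> and at most 2d + 1 elsewhere in the component.\<close>
    obtain c where c: "\<And>e. c e = 1 \<or> c e = (-1::int)" "\<bar>excess G E' c s\<bar> \<le> 2"
      "\<And>v. reach G E' s v \<Longrightarrow> v \<noteq> s \<Longrightarrow> \<bar>excess G E' c v\<bar> \<le> 1"
      using balanced_signs[OF E'_edges, of s] by blast
    obtain v where v: "reach G E' x v" "2 * int d + 1 < int (deg_in G E' v) + \<bar>excess G E' c v\<bar>"
      using unbalanced[of c, OF c(1)] by metis
    have "reach G E' s v"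
      using reach_sym[OF s] v(1) by (rule rtranclp_trans)
    then show False
      using v(2) c(2) c(3)[of v] lt deg[of v] by (cases "v = s") auto
  qed
  define C where "C = {v. reach G E' x v}"
  have "C \<subseteq> insert x (\<Union>e\<in>E'. ends G e)"
  proof
    fix v assume "v \<in> C"
    then have "reach G E' x v"
      by (simp add: C_def)
    then show "v \<in> insert x (\<Union>e\<in>E'. ends G e)"
      by cases (auto simp: joined_def)
  qed
  moreover have "finite (ends G e)" if "e \<in> E'" for e
    using card_ends[of e] E'_edges that card.infinite by fastforce
  ultimately show finC: "finite {v. reach G E' x v}"
    using fin unfolding C_def by (meson finite.insertI finite_UN_I finite_subset)
  have closed: "ends G e \<subseteq> C" if "e \<in> E'" "ends G e \<inter> C \<noteq> {}" for e
    using reach_closed[OF that(1) E'_edges] that(2) by (auto simp: C_def)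
  define H where "H = {e \<in> E'. ends G e \<subseteq> C}"
  show "g \<le> card {v. reach G E' x v}"
  proof (rule ccontr)
    assume small: "\<not> g \<le> card {v. reach G E' x v}"
    \<comment> \<open>An odd cycle within the component would have at most \<open>card C\<close>
      vertices, which is less than \<open>g\<close>.\<close>
    have "\<not> (is_cycle G vs es \<and> odd (length es) \<and> set es \<subseteq> H)" for vs es
    proof
      assume cyc: "is_cycle G vs es \<and> odd (length es) \<and> set es \<subseteq> H"
      have "set vs \<subseteq> C"
      proof
        fix v assume "v \<in> set vs"
        then obtain i where "i < length es" "v \<in> ends G (es ! i)"
          using cyc by (auto simp: is_cycle_def in_set_conv_nth)
        then have "es ! i \<in> H"
          using cyc nth_mem by blast
        then show "v \<in> C"
          using \<open>v \<in> ends G (es ! i)\<close> by (auto simp: H_def)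
      qed
      then have "length es \<le> card C"
        using cyc finC card_mono[of C "set vs"] by (auto simp: is_cycle_def distinct_card C_def)
      then show False
        using odd_cycles[of vs es] cyc small by (auto simp: C_def)
    qed
    moreover have "H \<subseteq> edges G"
      using E'_edges by (auto simp: H_def)
    ultimately have "\<exists>s :: 'v \<Rightarrow> bool. \<forall>e\<in>H. \<forall>u w. ends G e = {u, w} \<longrightarrow> s u \<noteq> s w"
      using two_coloring_or_odd_cycle[of H] by metis
    then obtain s :: "'v \<Rightarrow> bool" where
      s: "\<And>e u w. e \<in> H \<Longrightarrow> ends G e = {u, w} \<Longrightarrow> s u \<noteq> s w"
      by metis
    obtain c where c: "\<And>e. c e = 1 \<or> c e = (-1::int)"
      "\<And>v. reach G E' x v \<Longrightarrow> v \<noteq> x \<Longrightarrow> \<bar>excess G E' c v\<bar> \<le> 1"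
      using balanced_signs[OF E'_edges, of x] by blast
    \<comment> \<open>The excess has the parity of the degree 2d, so absolute value at most 1 forces
      it to be 0.\<close>
    have zero: "excess G E' c v = 0" if "v \<in> C" "v \<noteq> x" for v
      using c(2)[of v] regular[of v] excess_eq_diff[of E' c G v, OF fin c(1)] that
      unfolding C_def by simp presburger
    define P where "P = (\<lambda>b. {v \<in> C. (s v = s x) = b})"
    have "(\<Sum>v\<in>P b. excess G H c v) = sum c H" for b
    proof (rule sum_excess_transversal)
      fix e assume e: "e \<in> H"
      then obtain u w where uw: "ends G e = {u, w}"
        using card_ends[of e] E'_edges by (auto simp: H_def card_2_iff)
      have "P b \<inter> ends G e = {if (s u = s x) = b then u else w}"
        using s[OF e uw] e uw by (auto simp: P_def H_def)
      then show "card (P b \<inter> ends G e) = 1"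
        by simp
    qed (use fin finC in \<open>auto simp: P_def H_def C_def\<close>)
    moreover have "excess G H c v = excess G E' c v" if "v \<in> C" for v
      unfolding excess_def using closed that by (intro sum.cong) (auto simp: H_def)
    ultimately have sides: "(\<Sum>v\<in>P b. excess G E' c v) = sum c H" for b
      by (metis (no_types, lifting) P_def mem_Collect_eq sum.cong)
    have xC: "x \<in> C"
      by (simp add: C_def)
    have "(\<Sum>v\<in>P True. excess G E' c v) = excess G E' c x"
    proof -
      have "(\<Sum>v\<in>P True. excess G E' c v) = (\<Sum>v\<in>{x}. excess G E' c v)"
        by (rule sum.mono_neutral_right) (use xC finC zero in \<open>auto simp: P_def C_def\<close>)
      then show ?thesis by simp
    qed
    moreover have "(\<Sum>v\<in>P False. excess G E' c v) = 0"
      by (rule sum.neutral) (use zero in \<open>auto simp: P_def\<close>)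
    ultimately have "excess G E' c x = 0"
      using sides by metis
    then have "excess G E' c v = 0" if "reach G E' x v" for v
      using zero[of v] that by (cases "v = x") (auto simp: C_def)
    then show False
      using unbalanced[of c] c(1) regular by force
  qed
qed

end

section \<open>Moving the uncolored edge and Kempe swaps in a regular component\<close>

locale kempe_component = uncolorable G F d k D g
  for G :: "('v, 'e) pre_multigraph" and F d k D g +
  fixes \<alpha> \<beta> :: nat and E' :: "'e set" and C :: "'v set"
  assumes colors: "\<alpha> \<noteq> \<beta>" "\<alpha> < k" "\<beta> < k"
    and E'_subset: "E' \<subseteq> F"
    and component: "u \<in> C \<Longrightarrow> v \<in> C \<longleftrightarrow> reach G E' u v"
    and regular: "v \<in> C \<Longrightarrow> deg_in G E' v = 2 * d"
    and finite_C: "finite C"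
    and card_C: "g \<le> card C"
begin

text \<open>The locale fixes \<open>E'\<close> and \<open>C\<close>, while the coloring and its
  uncolored edge \<open>f\<close> vary. The last conjunct says that, on F - {f}, the colors
  \<open>\<alpha>\<close> and \<open>\<beta>\<close> occupy exactly \<open>E'\<close> without
  \<open>f\<close>, so the component stays the same from one state to the next.\<close>

definition state :: "('e \<Rightarrow> nat) \<Rightarrow> 'e \<Rightarrow> bool" where
  "state \<phi> f \<longleftrightarrow> f \<in> E' \<and> ends G f \<subseteq> C \<and> defective_on G d k (F - {f}) \<phi> \<and> E' = two_colors \<phi> f \<alpha> \<beta>"

text \<open>Counting only outside \<open>E'\<close> makes this independent of the position of the
  uncolored edge. For \<gamma> other than \<open>\<alpha>\<close> and \<open>\<beta>\<close> nothing
  is lost, by \<open>class_eq\<close>.\<close>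

definition missing :: "('e \<Rightarrow> nat) \<Rightarrow> nat \<Rightarrow> 'v \<Rightarrow> bool" where
  "missing \<phi> \<gamma> v \<longleftrightarrow> deg_in G {e \<in> F - E'. \<phi> e = \<gamma>} v < d"

lemma class_eq:
  assumes "state \<phi> f" "\<gamma> \<noteq> \<alpha>" "\<gamma> \<noteq> \<beta>"
  shows "{e \<in> F - {f}. \<phi> e = \<gamma>} = {e \<in> F - E'. \<phi> e = \<gamma>}"
  using assms by (auto simp: state_def two_colors_def)

lemma missing_cong:
  assumes "\<And>e. e \<in> F - E' \<Longrightarrow> \<psi> e = \<phi> e"
  shows "missing \<psi> \<gamma> v \<longleftrightarrow> missing \<phi> \<gamma> v"
proof -
  have "{e \<in> F - E'. \<psi> e = \<gamma>} = {e \<in> F - E'. \<phi> e = \<gamma>}"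
    using assms by auto
  then show ?thesis
    by (simp add: missing_def)
qed

lemma finite_E': "finite E'" and E'_edges: "E' \<subseteq> edges G"
  using E'_subset finite_F F_edges by (auto intro: finite_subset)

text \<open>Without \<open>f'\<close> both of its ends have degree 2d - 1 in \<open>E'\<close>, so
  each tolerates excess up to 2 in absolute value, while the remaining vertices of \<open>C\<close>
  have degree 2d and excess at most 1. Hence the balanced signs yield a recoloring of the component
  that leaves only \<open>f'\<close> uncolored.\<close>

lemma move_uncolored:
  assumes st: "state \<phi> f" and f': "f' \<in> E'" "ends G f' = {u, w}" "u \<in> C"
  obtains \<psi> where "state \<psi> f'" "\<And>e. e \<in> F - E' \<Longrightarrow> \<psi> e = \<phi> e"
proof -
  have E': "E' = two_colors \<phi> f \<alpha> \<beta>" and f: "f \<in> F" "ends G f \<subseteq> C"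
    and \<phi>: "defective_on G d k (F - {f}) \<phi>"
    using st E'_subset by (auto simp: state_def)
  have "card (ends G f) = 2"
    using f(1) F_edges card_ends by blast
  then obtain x where x: "x \<in> ends G f"
    by (metis card.empty equals0I zero_neq_numeral)
  have reach_x: "v \<in> C \<longleftrightarrow> reach G E' x v" for v
    using component[of x v] f(2) x by blast
  have "w \<in> C"
    using reach_closed[OF f'(1) E'_edges, of u x w] f' reach_x by simp
  have uw: "u \<noteq> w"
    using card_ends[of f'] E'_edges f' by auto
  have sub: "E' - {f'} \<subseteq> edges G"
    using E'_edges by blast
  obtain c where c: "\<And>e. c e = 1 \<or> c e = (-1::int)" "c f' = 1"
    "excess G (E' - {f'}) c w \<in> {-2..0}" "excess G (E' - {f'}) c u \<in> {-2..1}"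
    "\<And>v. reach G E' u v \<Longrightarrow> v \<noteq> u \<Longrightarrow> v \<noteq> w \<Longrightarrow> \<bar>excess G (E' - {f'}) c v\<bar> \<le> 1"
    using balanced_signs_minus_edge[OF E'_edges f'(1,2) balanced_signs[OF sub]] by blast
  have "int (deg_in G (E' - {f'}) v) + \<bar>excess G (E' - {f'}) c v\<bar> \<le> 2 * int d + 1" if "v \<in> C" for v
  proof -
    have "deg_in G E' v = deg_in G (E' - {f'}) v + (if v \<in> {u, w} then 1 else 0)"
      using deg_in_insert[of "E' - {f'}" f' G v] finite_E' f' by (simp add: insert_absorb)
    moreover have "deg_in G E' v = 2 * d" "reach G E' u v"
      using regular component f'(3) that by auto
    ultimately show ?thesis
      using c(3,4) c(5)[of v] d_pos by (cases "v = u"; cases "v = w") auto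
  qed
  then have "deg_in G {e \<in> E' - {f'}. c e = 1} v \<le> d" "deg_in G {e \<in> E' - {f'}. c e \<noteq> 1} v \<le> d"
    if "v \<in> C" for v
    using signs_halve[of "E' - {f'}" c G v d] c(1) finite_E' that by auto
  moreover have "(F - {f'}) \<inter> E' = E' - {f'}"
    using E'_subset by auto
  ultimately have small: "deg_in G {e \<in> (F - {f'}) \<inter> E'. c e = 1} v \<le> d"
      "deg_in G {e \<in> (F - {f'}) \<inter> E'. c e \<noteq> 1} v \<le> d" if "reach G E' x v" for v
    using reach_x that by simp_all
  obtain \<psi> where \<psi>: "defective_on G d k (F - {f'}) \<psi>"
    "\<And>e. e \<in> (F - {f'}) - E' \<Longrightarrow> \<psi> e = \<phi> e" "\<And>e. e \<in> (F - {f'}) \<inter> E' \<Longrightarrow> \<psi> e \<in> {\<alpha>, \<beta>}"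
    by (rule recolor_component[OF f(1) x \<phi> colors E' Diff_subset small]) (assumption+, rule that)
  have keep: "\<psi> e = \<phi> e" if "e \<in> F - E'" for e
    using \<psi>(2)[of e] that f'(1) by auto
  \<comment> \<open>The old gap \<open>f\<close> now has color \<open>\<alpha>\<close> or
    \<open>\<beta>\<close>, and the edges outside \<open>E'\<close> keep colors different from
    both.\<close>
  have "E' = two_colors \<psi> f' \<alpha> \<beta>"
  proof -
    have "e \<in> E' \<longleftrightarrow> \<psi> e = \<alpha> \<or> \<psi> e = \<beta>" if "e \<in> F - {f'}" for e
    proof (cases "e \<in> E'")
      case True
      then show ?thesis using \<psi>(3)[of e] that by auto
    next
      case False
      then have "\<phi> e \<noteq> \<alpha> \<and> \<phi> e \<noteq> \<beta>"
        using that by (auto simp: E' two_colors_def)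
      then show ?thesis using False keep[of e] that by auto
    qed
    then show ?thesis
      using E'_subset f'(1) by (auto simp: two_colors_def)
  qed
  then have "state \<psi> f'"
    unfolding state_def using f' \<open>w \<in> C\<close> \<psi>(1) by simp
  then show ?thesis
    using that keep by blast
qed

lemma no_common_missing:
  assumes "state \<phi> f" "ends G f = {u, w}" "\<gamma> < k" "\<gamma> \<noteq> \<alpha>" "\<gamma> \<noteq> \<beta>" "missing \<phi> \<gamma> u" "missing \<phi> \<gamma> w"
  shows False
proof (rule color_with_missing)
  show "f \<in> F" "defective_on G d k (F - {f}) \<phi>"
    using assms(1) E'_subset by (auto simp: state_def)
next
  have "{e \<in> F - {f}. \<phi> e = \<gamma>} = {e \<in> F - E'. \<phi> e = \<gamma>}"
    by (rule class_eq[OF assms(1,4,5)])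
  then show "deg_in G {e \<in> F - {f}. \<phi> e = \<gamma>} u < d" "deg_in G {e \<in> F - {f}. \<phi> e = \<gamma>} w < d"
    using assms(6,7) unfolding missing_def by metis+
qed (use assms in auto)

text \<open>Suppose that \<gamma> falls short by at least 2 at \<open>u\<close>. Move the gap to an
  edge from \<open>u\<close> to some \<open>w\<close>. There \<open>\<alpha>\<close> and
  \<open>\<beta>\<close> together have degree 2d - 1, so one of them, \<delta>, is deficient at
  \<open>w\<close>. By \<open>two_color_component\<close> the \<gamma>\<delta>-component is
  2d-regular, but \<open>u\<close> has degree at most (d - 2) + d + 1 in it.\<close>

lemma deficiency_le_1:
  assumes st: "state \<phi> f" and "u \<in> C" "\<gamma> < k" "\<gamma> \<noteq> \<alpha>" "\<gamma> \<noteq> \<beta>"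
  shows "d \<le> deg_in G {e \<in> F - E'. \<phi> e = \<gamma>} u + 1"
proof (rule ccontr)
  assume "\<not> ?thesis"
  then have u: "deg_in G {e \<in> F - E'. \<phi> e = \<gamma>} u + 1 < d"
    by simp
  have "deg_in G E' u \<noteq> 0"
    using regular[OF \<open>u \<in> C\<close>] d_pos by simp
  then have "{e \<in> E'. u \<in> ends G e} \<noteq> {}"
    unfolding deg_in_def by (metis card.empty)
  then obtain f' where f': "f' \<in> E'" "u \<in> ends G f'"
    by blast
  then obtain w where uw: "ends G f' = {u, w}"
    using obtain_ends E'_edges by (metis subsetD)
  obtain \<psi> where \<psi>: "state \<psi> f'" "\<And>e. e \<in> F - E' \<Longrightarrow> \<psi> e = \<phi> e"
    using move_uncolored[OF st f'(1) uw \<open>u \<in> C\<close>] by blast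
  then have E'': "E' = two_colors \<psi> f' \<alpha> \<beta>" and good: "defective_on G d k (F - {f'}) \<psi>"
    and fF: "f' \<in> F" and wC: "w \<in> C"
    using E'_subset uw by (auto simp: state_def)
  have "deg_in G {e \<in> F - {f'}. \<psi> e = \<alpha>} w + deg_in G {e \<in> F - {f'}. \<psi> e = \<beta>} w + 1 = 2 * d"
    using deg_two_colors[OF colors(1), of \<psi> f' w] E'' regular[OF wC] uw by auto
  then have "deg_in G {e \<in> F - {f'}. \<psi> e = \<alpha>} w < d \<or> deg_in G {e \<in> F - {f'}. \<psi> e = \<beta>} w < d"
    by linarith
  then obtain \<delta> where \<delta>: "\<delta> \<in> {\<alpha>, \<beta>}" "deg_in G {e \<in> F - {f'}. \<psi> e = \<delta>} w < d"
    by blast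
  have le: "deg_in G {e \<in> F - {f'}. \<psi> e = \<epsilon>} v \<le> d" for \<epsilon> v
    using good by (auto simp: defective_on_def)
  have "{e \<in> F - {f'}. \<psi> e = \<gamma>} = {e \<in> F - E'. \<phi> e = \<gamma>}"
    using class_eq[OF \<psi>(1) assms(4,5)] \<psi>(2) by auto
  then have u': "deg_in G {e \<in> F - {f'}. \<psi> e = \<gamma>} u + 1 < d"
    using u by simp
  have "\<gamma> \<noteq> \<delta>" "\<delta> < k"
    using \<delta> colors assms by auto
  then have "deg_in G (two_colors \<psi> f' \<gamma> \<delta>) u = 2 * d"
    using two_color_component(1)[OF fF uw good _ \<open>\<gamma> < k\<close>, of \<delta> "two_colors \<psi> f' \<gamma> \<delta>" u]
      le[of \<gamma> w] le[of \<delta> u] u' \<delta>(2) by auto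
  then show False
    using deg_two_colors[OF \<open>\<gamma> \<noteq> \<delta>\<close>, of \<psi> f' u] le[of \<delta> u] u' uw by auto
qed

lemma card_other_colors: "int (card ({..<k} - {\<alpha>, \<beta>})) = int k - 2"
proof -
  have "card {\<alpha>, \<beta>} \<le> card {..<k}"
    by (rule card_mono) (use colors in auto)
  then show ?thesis
    using colors by (subst card_Diff_subset) auto
qed

text \<open>The edges of \<open>E'\<close> use up 2d of the degree at \<open>v\<close>, so the k - 2
  other colors have total degree at most D - 2d there. The total deficiency is therefore at least (k
  - 2) d - (D - 2d).\<close>

lemma sum_deficiency:
  assumes st: "state \<phi> f" and "v \<in> C"
  shows "int (k * d) - int D \<le> (\<Sum>\<gamma>\<in>{..<k} - {\<alpha>, \<beta>}. int d - int (deg_in G {e \<in> F - E'. \<phi> e = \<gamma>} v))"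
proof -
  let ?A = "{..<k} - {\<alpha>, \<beta>}"
  have "\<phi> e \<in> ?A" if "e \<in> F - E'" for e
    using st that by (auto simp: state_def two_colors_def defective_on_def)
  then have "(\<Sum>\<gamma>\<in>?A. deg_in G {e \<in> F - E'. \<phi> e = \<gamma>} v) = deg_in G (F - E') v"
    by (intro sum_deg_in_classes) (use finite_F in auto)
  moreover have "deg_in G (F - E') v + 2 * d \<le> D"
    using deg_in_Un[of E' "F - E'" G v] finite_F finite_E' regular[OF \<open>v \<in> C\<close>] deg_le[of v] E'_subset
    by (simp add: Un_absorb1)
  moreover have "int d * int (card ?A) = int d * (int k - 2)"
    by (simp only: card_other_colors)
  ultimately show ?thesis
    by (simp add: sum_subtractf of_nat_sum[symmetric] algebra_simps)
qed

text \<open>A rearrangement of \<open>enough_colors\<close>. The distinct colors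
  \<open>\<alpha>\<close> and \<open>\<beta>\<close> below \<open>k\<close> give k \<ge> 2, so the
  product, and with it its second factor, is positive.\<close>

lemma slack: "int k - 1 \<le> int g * (int (k * d) - int D)" and slack_pos: "0 < int (k * d) - int D"
proof -
  have "int (g * D + k) \<le> int (g * (k * d) + 1)"
    using enough_colors by (rule of_nat_mono)
  then show *: "int k - 1 \<le> int g * (int (k * d) - int D)"
    by (simp add: algebra_simps)
  moreover have "0 < int k - 1"
    using colors by auto
  ultimately have "0 < int g * (int (k * d) - int D)"
    by linarith
  then show "0 < int (k * d) - int D"
    using zero_less_mult_pos g_ge by (metis of_nat_0_le_iff order_le_less zero_less_mult_iff not_less_iff_gr_or_eq)
qed

lemma ex_missing:
  assumes st: "state \<phi> f" and "v \<in> C"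
  obtains \<gamma> where "\<gamma> < k" "\<gamma> \<noteq> \<alpha>" "\<gamma> \<noteq> \<beta>" "missing \<phi> \<gamma> v"
proof -
  have "0 < (\<Sum>\<gamma>\<in>{..<k} - {\<alpha>, \<beta>}. int d - int (deg_in G {e \<in> F - E'. \<phi> e = \<gamma>} v))"
    using sum_deficiency[OF assms] slack_pos by linarith
  then have "\<not> (\<forall>\<gamma>\<in>{..<k} - {\<alpha>, \<beta>}. int d - int (deg_in G {e \<in> F - E'. \<phi> e = \<gamma>} v) \<le> 0)"
    using sum_nonpos by (metis (no_types, lifting) not_less)
  then obtain \<gamma> where "\<gamma> \<in> {..<k} - {\<alpha>, \<beta>}" "\<not> int d - int (deg_in G {e \<in> F - E'. \<phi> e = \<gamma>} v) \<le> 0"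
    by blast
  then show ?thesis
    using that[of \<gamma>] by (simp add: missing_def)
qed

text \<open>Exchanging \<gamma> and \<delta> on the \<gamma>\<delta>-component of \<open>x\<close>
  makes \<open>x\<close> miss \<gamma> instead of \<delta>. By \<open>two_color_component\<close>
  all degrees there are 2d. The vertex \<open>z\<close> has smaller degree, as it misses \<gamma>
  and is not an end of \<open>f\<close>; so it lies outside and the swap does not affect it. The set
  \<open>E'\<close> is unchanged because the four colors are distinct.\<close>

lemma kempe_swap:
  assumes st: "state \<phi> f" and f: "ends G f = {u, x}"
    and \<gamma>: "\<gamma> < k" "\<gamma> \<noteq> \<alpha>" "\<gamma> \<noteq> \<beta>" and \<delta>: "\<delta> < k" "\<delta> \<noteq> \<alpha>" "\<delta> \<noteq> \<beta>" and "\<gamma> \<noteq> \<delta>"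
    and u: "missing \<phi> \<gamma> u" and x: "missing \<phi> \<delta> x" and z: "missing \<phi> \<gamma> z" "z \<noteq> u" "z \<noteq> x"
  obtains \<psi> where "state \<psi> f" "missing \<psi> \<gamma> x" "missing \<psi> \<gamma> z"
proof -
  have E': "E' = two_colors \<phi> f \<alpha> \<beta>" and good: "defective_on G d k (F - {f}) \<phi>" and fF: "f \<in> F"
    using st E'_subset by (auto simp: state_def)
  have le: "deg_in G {e \<in> F - {f}. \<phi> e = \<epsilon>} v \<le> d" for \<epsilon> v
    using good by (auto simp: defective_on_def)
  have eq: "{e \<in> F - {f}. \<phi> e = \<gamma>} = {e \<in> F - E'. \<phi> e = \<gamma>}" "{e \<in> F - {f}. \<phi> e = \<delta>} = {e \<in> F - E'. \<phi> e = \<delta>}"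
    using class_eq[OF st] \<gamma> \<delta> by auto
  define E2 where "E2 = two_colors \<phi> f \<gamma> \<delta>"
  define C2 where "C2 = {v. reach G E2 x v}"
  \<comment> \<open>The edge \<open>f\<close> counts toward the regularity of the component but
    stays uncolored in the swap.\<close>
  define K where "K = {e \<in> E2 - {f}. ends G e \<subseteq> C2}"
  have f': "ends G f = {x, u}"
    using f by auto
  have "deg_in G E2 v = 2 * d" if "v \<in> C2" for v
    using two_color_component(1)[OF fF f' good \<open>\<gamma> \<noteq> \<delta>\<close> \<gamma>(1) \<delta>(1) _ _ E2_def, of v] that
      le[of \<gamma> x] le[of \<delta> u] u x eq by (auto simp: missing_def C2_def)
  moreover have "deg_in G E2 z < 2 * d"
    using deg_two_colors[OF \<open>\<gamma> \<noteq> \<delta>\<close>, of \<phi> f z] le[of \<delta> z] z f eq by (auto simp: missing_def E2_def)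
  ultimately have zC2: "z \<notin> C2"
    by fastforce
  have E2_edges: "E2 \<subseteq> edges G"
    using two_colors_subset[OF fF] F_edges unfolding E2_def by blast
  have closed: "ends G e \<subseteq> C2" if "e \<in> E2" "ends G e \<inter> C2 \<noteq> {}" for e
    using reach_closed[OF that(1) E2_edges] that(2) by (auto simp: C2_def)
  define \<psi> where "\<psi> = (\<lambda>e. if e \<in> K then if \<phi> e = \<gamma> then \<delta> else \<gamma> else \<phi> e)"
  have K: "e \<in> F \<and> e \<noteq> f \<and> \<phi> e \<in> {\<gamma>, \<delta>}" if "e \<in> K" for e
    using that by (auto simp: K_def E2_def two_colors_def)
  have inK: "e \<in> K" if "e \<in> F - {f}" "\<phi> e \<in> {\<gamma>, \<delta>}" "v \<in> ends G e" "v \<in> C2" for e v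
    using that closed[of e] by (auto simp: K_def E2_def two_colors_def)
  have "defective_on G d k (F - {f}) \<psi>"
  proof (rule defective_on_recolor[OF _ good, where K = K and C = C2 and \<alpha> = \<gamma> and \<beta> = \<delta>])
    fix v \<epsilon> assume "\<epsilon> \<in> {\<gamma>, \<delta>}"
    then have "deg_in G {e \<in> (F - {f}) \<inter> K. \<psi> e = \<epsilon>} v
        \<le> deg_in G {e \<in> F - {f}. \<phi> e = (if \<epsilon> = \<gamma> then \<delta> else \<gamma>)} v"
      by (intro deg_in_mono) (use K \<open>\<gamma> \<noteq> \<delta>\<close> finite_F in \<open>auto simp: \<psi>_def split: if_splits\<close>)
    then show "deg_in G {e \<in> (F - {f}) \<inter> K. \<psi> e = \<epsilon>} v \<le> d"
      using le le_trans by blast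
  next
    fix e assume "e \<in> F - {f}" "e \<notin> K" "\<phi> e \<in> {\<gamma>, \<delta>}"
    then show "ends G e \<inter> C2 = {}"
      using inK by blast
  qed (use \<gamma> \<delta> finite_F in \<open>auto simp: \<psi>_def K_def\<close>)
  moreover have "\<psi> e = \<epsilon> \<longleftrightarrow> \<phi> e = \<epsilon>" if "\<epsilon> \<in> {\<alpha>, \<beta>}" for e \<epsilon>
    using K[of e] \<gamma> \<delta> that by (auto simp: \<psi>_def)
  then have "two_colors \<psi> f \<alpha> \<beta> = two_colors \<phi> f \<alpha> \<beta>"
    by (auto simp: two_colors_def)
  ultimately have "state \<psi> f"
    using st unfolding state_def by metis
  moreover have "missing \<psi> \<gamma> x"
  proof -
    have "\<phi> e = \<delta>" if e: "e \<in> F - E'" "\<psi> e = \<gamma>" "x \<in> ends G e" for e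
    proof -
      have "e \<in> F - {f}" "x \<in> C2"
        using e st by (auto simp: state_def C2_def)
      then have "e \<in> K"
        using inK[of e x] e(2,3) by (cases "e \<in> K") (auto simp: \<psi>_def)
      then show ?thesis
        using e(2) K[of e] \<open>\<gamma> \<noteq> \<delta>\<close> by (auto simp: \<psi>_def)
    qed
    then have "deg_in G {e \<in> F - E'. \<psi> e = \<gamma>} x \<le> deg_in G {e \<in> F - E'. \<phi> e = \<delta>} x"
      by (intro deg_in_mono) (use finite_F in auto)
    then show ?thesis
      using x by (simp add: missing_def)
  qed
  moreover have "missing \<psi> \<gamma> z"
  proof -
    have "deg_in G {e \<in> F - E'. \<psi> e = \<gamma>} z \<le> deg_in G {e \<in> F - E'. \<phi> e = \<gamma>} z"
      by (intro deg_in_mono) (use finite_F zC2 in \<open>auto simp: \<psi>_def K_def split: if_splits\<close>)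
    then show ?thesis
      using z by (simp add: missing_def)
  qed
  ultimately show ?thesis
    by (rule that)
qed

text \<open>Induction along a walk from \<open>u\<close> to \<open>z\<close> in \<open>E'\<close>,
  for all colorings at once because each step changes the coloring. With the gap moved to the first
  edge of the walk, a swap transfers the missing \<gamma> from \<open>u\<close> to the next vertex
  \<open>x\<close>, and the walk gets shorter.\<close>

lemma missing_unique:
  assumes "state \<phi> f" "u \<in> C" "z \<in> C" "\<gamma> < k" "\<gamma> \<noteq> \<alpha>" "\<gamma> \<noteq> \<beta>" "missing \<phi> \<gamma> u" "missing \<phi> \<gamma> z"
  shows "u = z"
proof -
  have "reach G E' u z"
    using component assms by blast
  then show ?thesis
    using assms(1,2,7,8)
  proof (induction arbitrary: \<phi> f rule: converse_rtranclp_induct)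
    case (step u x)
    obtain f' where f': "f' \<in> E'" "ends G f' = {u, x}"
      using step.hyps(1) by (auto simp: joined_def)
    obtain \<psi> where \<psi>: "state \<psi> f'" "\<And>e. e \<in> F - E' \<Longrightarrow> \<psi> e = \<phi> e"
      using move_uncolored[OF step.prems(1) f' step.prems(2)] by blast
    have m: "missing \<psi> \<gamma> u" "missing \<psi> \<gamma> z"
      using missing_cong[OF \<psi>(2)] step.prems by auto
    \<comment> \<open>If both ends of the gap \<open>f'\<close> missed \<gamma>, then
      \<open>f'\<close> could be colored.\<close>
    have x: "x \<in> C" "\<not> missing \<psi> \<gamma> x"
      using \<psi>(1) f' no_common_missing[OF \<psi>(1) f'(2) assms(4-6) m(1)] by (auto simp: state_def)
    obtain \<delta> where \<delta>: "\<delta> < k" "\<delta> \<noteq> \<alpha>" "\<delta> \<noteq> \<beta>" "missing \<psi> \<delta> x"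
      using ex_missing[OF \<psi>(1) x(1)] by blast
    show ?case
    proof (rule ccontr)
      assume "u \<noteq> z"
      obtain \<chi> where "state \<chi> f'" "missing \<chi> \<gamma> x" "missing \<chi> \<gamma> z"
        using kempe_swap[OF \<psi>(1) f'(2) assms(4-6) \<delta>(1-3) _ m(1) \<delta>(4) m(2)] x(2) \<delta>(4) m(2) \<open>u \<noteq> z\<close>
        by metis
      \<comment> \<open>The induction hypothesis is applied to \<open>\<chi>\<close>; the
        contradiction arises in \<open>\<psi>\<close>, where \<open>z\<close> misses \<gamma> and
        \<open>x\<close> does not.\<close>
      then have "x = z"
        using step.IH x(1) by blast
      then show False
        using x(2) m(2) by simp
    qed
  qed simp
qed

section \<open>Counting deficiencies over the component\<close>

lemma no_state: "\<not> state \<phi> f"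
proof
  assume st: "state \<phi> f"
  let ?A = "{..<k} - {\<alpha>, \<beta>}"
  define def where "def = (\<lambda>\<gamma> v. int d - int (deg_in G {e \<in> F - E'. \<phi> e = \<gamma>} v))"
  have total: "(\<Sum>v\<in>C. def \<gamma> v) \<le> 1" if \<gamma>: "\<gamma> \<in> ?A" for \<gamma>
  proof (cases "\<exists>u\<in>C. missing \<phi> \<gamma> u")
    case True
    then obtain u where u: "u \<in> C" "missing \<phi> \<gamma> u"
      by blast
    \<comment> \<open>Only \<open>u\<close> can have positive deficiency, by
      \<open>missing_unique\<close>, and \<open>deficiency_le_1\<close> bounds it there.\<close>
    have "def \<gamma> v \<le> (if v = u then 1 else 0)" if "v \<in> C" for v
    proof (cases "v = u")
      case True
      then show ?thesis
        using deficiency_le_1[OF st that, of \<gamma>] \<gamma> by (simp add: def_def)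
    next
      case False
      then have "\<not> missing \<phi> \<gamma> v"
        using missing_unique[OF st u(1) that, of \<gamma>] u(2) \<gamma> by blast
      then show ?thesis
        using False by (simp add: def_def missing_def)
    qed
    then have "(\<Sum>v\<in>C. def \<gamma> v) \<le> (\<Sum>v\<in>C. if v = u then 1 else 0)"
      by (rule sum_mono)
    then show ?thesis
      using finite_C u(1) by (simp add: sum.delta)
  next
    case False
    then have "(\<Sum>v\<in>C. def \<gamma> v) \<le> 0"
      by (intro sum_nonpos) (auto simp: def_def missing_def)
    then show ?thesis by simp
  qed
  have "int k - 1 \<le> int g * (int (k * d) - int D)"
    by (rule slack)
  \<comment> \<open>The component has at least \<open>g\<close> vertices, and the factor it
    multiplies is positive.\<close>
  also have "\<dots> \<le> int (card C) * (int (k * d) - int D)"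
    using card_C slack_pos by (intro mult_right_mono) auto
  also have "\<dots> = (\<Sum>v\<in>C. int (k * d) - int D)"
    by simp
  also have "\<dots> \<le> (\<Sum>v\<in>C. \<Sum>\<gamma>\<in>?A. def \<gamma> v)"
    unfolding def_def by (rule sum_mono) (rule sum_deficiency[OF st])
  also have "\<dots> = (\<Sum>\<gamma>\<in>?A. \<Sum>v\<in>C. def \<gamma> v)"
    by (rule sum.swap)
  also have "\<dots> \<le> (\<Sum>\<gamma>\<in>?A. 1)"
    using total by (rule sum_mono)
  also have "\<dots> = int (card ?A)"
    by simp
  also have "\<dots> = int k - 2"
    by (rule card_other_colors)
  finally show False by simp
qed

end

section \<open>Adding the edges one by one\<close>

lemma (in uncolorable) uncolorable_remove_edge:
  assumes f: "f \<in> F"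
  shows "\<not> defective_on G d k (F - {f}) \<phi>"
proof
  assume good: "defective_on G d k (F - {f}) \<phi>"
  obtain x y where xy: "ends G f = {x, y}" "x \<noteq> y"
    using card_ends[of f] f F_edges by (auto simp: card_2_iff)
  have le: "deg_in G {e \<in> F - {f}. \<phi> e = \<epsilon>} v \<le> d" for \<epsilon> v
    using good by (auto simp: defective_on_def)
  \<comment> \<open>Otherwise g D \<ge> g k d + g with g \<ge> 2, against
    \<open>enough_colors\<close>.\<close>
  have D: "D \<le> k * d"
  proof (rule ccontr)
    assume "\<not> D \<le> k * d"
    then have "g * (k * d + 1) \<le> g * D"
      by (intro mult_le_mono) auto
    then show False
      using enough_colors g_ge by (simp add: algebra_simps)
  qed
  \<comment> \<open>Without \<open>f\<close> an end of \<open>f\<close> has degree below D \<le> k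
    d, so not all \<open>k\<close> colors can reach degree \<open>d\<close> there.\<close>
  have deficient: "\<exists>\<gamma><k. deg_in G {e \<in> F - {f}. \<phi> e = \<gamma>} v < d" if v: "v \<in> {x, y}" for v
  proof (rule ccontr)
    assume "\<not> ?thesis"
    then have "d \<le> deg_in G {e \<in> F - {f}. \<phi> e = \<gamma>} v" if "\<gamma> < k" for \<gamma>
      using that by (meson not_less)
    then have "(\<Sum>\<gamma><k. d) \<le> (\<Sum>\<gamma><k. deg_in G {e \<in> F - {f}. \<phi> e = \<gamma>} v)"
      by (intro sum_mono) (simp only: lessThan_iff)
    also have "\<dots> = deg_in G (F - {f}) v"
      by (rule sum_deg_in_classes) (use good finite_F in \<open>auto simp: defective_on_def\<close>)
    also have "\<dots> < deg_in G F v"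
      using deg_in_insert[of "F - {f}" f G v] finite_F f v xy by (simp add: insert_absorb)
    also have "\<dots> \<le> D"
      by (rule deg_le)
    finally show False
      using D by simp
  qed
  then obtain \<alpha> \<beta> where \<alpha>: "\<alpha> < k" "deg_in G {e \<in> F - {f}. \<phi> e = \<alpha>} x < d"
    and \<beta>: "\<beta> < k" "deg_in G {e \<in> F - {f}. \<phi> e = \<beta>} y < d"
    by blast
  have "\<alpha> \<noteq> \<beta>"
    using color_with_missing[OF f good xy(1) \<alpha>] \<beta> by blast
  define E' where "E' = two_colors \<phi> f \<alpha> \<beta>"
  have x: "deg_in G {e \<in> F - {f}. \<phi> e = \<alpha>} x + deg_in G {e \<in> F - {f}. \<phi> e = \<beta>} x < 2 * d"
    using \<alpha>(2) le[of \<beta> x] by simp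
  have y: "deg_in G {e \<in> F - {f}. \<phi> e = \<alpha>} y + deg_in G {e \<in> F - {f}. \<phi> e = \<beta>} y < 2 * d"
    using \<beta>(2) le[of \<alpha> y] by simp
  note comp = two_color_component[OF f xy(1) good \<open>\<alpha> \<noteq> \<beta>\<close> \<alpha>(1) \<beta>(1) x y E'_def]
  have E'F: "E' \<subseteq> F"
    using two_colors_subset[OF f] E'_def by blast
  interpret kempe_component G F d k D g \<alpha> \<beta> E' "{v. reach G E' x v}"
  proof
    show "v \<in> {v. reach G E' x v} \<longleftrightarrow> reach G E' u v" if "u \<in> {v. reach G E' x v}" for u v
      using that reach_sym by (metis mem_Collect_eq rtranclp_trans)
  qed (use comp \<open>\<alpha> \<noteq> \<beta>\<close> \<alpha> \<beta> E'F in auto)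
  have "f \<in> E'"
    by (simp add: E'_def two_colors_def)
  then have "state \<phi> f"
    using reach_closed[of f E' x x] xy E'F F_edges good by (simp add: state_def) (simp add: E'_def)
  then show False
    using no_state by blast
qed

text \<open>If adding \<open>f\<close> to a colorable set destroyed colorability, the larger set
  would satisfy \<open>uncolorable\<close>, and \<open>uncolorable_remove_edge\<close> would deny
  the coloring of the smaller one.\<close>

lemma (in multigraph) ex_defective_on:
  assumes "\<And>v. deg_in G (edges G) v \<le> D"
    and "\<And>vs es. is_cycle G vs es \<Longrightarrow> odd (length es) \<Longrightarrow> g \<le> length es"
    and "1 \<le> d" "2 \<le> g" "g * D + k \<le> g * (k * d) + 1"
  shows "\<exists>\<phi>. defective_on G d k (edges G) \<phi>"
proof -
  have "\<exists>\<phi>. defective_on G d k F \<phi>" if "finite F" "F \<subseteq> edges G" for F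
    using that
  proof (induction F rule: finite_induct)
    case empty
    then show ?case
      by (simp add: defective_on_def deg_in_def)
  next
    case (insert f F)
    show ?case
    proof (rule ccontr)
      assume none: "\<not> ?thesis"
      interpret uncolorable G "insert f F" d k D g
      proof
        show "deg_in G (insert f F) v \<le> D" for v
        proof -
          have "deg_in G (insert f F) v \<le> deg_in G (edges G) v"
            by (rule deg_in_mono) (use finite_edges insert.prems in auto)
          then show ?thesis
            using assms(1)[of v] by simp
        qed
      qed (use assms insert none in auto)
      show False
        using uncolorable_remove_edge[of f] insert by auto
    qed
  qed
  then show ?thesis
    using finite_edges by blast
qed

section \<open>From colorings to the chromatic index\<close>

lemma defective_chromatic_index_le:
  fixes G :: "('v, 'e) pre_multigraph"
  assumes "multigraph G" "defective_on G d k (edges G) \<phi>"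
  shows "defective_chromatic_index d G \<le> k"
proof -
  interpret multigraph G by fact
  have "degree (color_class G \<phi> i) v \<le> d" for i v
    using assms(2) by (simp add: defective_on_def degree_def color_class_def deg_in_def)
  then have "defective_edge_coloring d G \<phi>"
    using finite_verts by (simp add: defective_edge_coloring_def max_degree_def color_class_def)
  moreover have "card (\<phi> ` edges G) \<le> card {..<k}"
    by (rule card_mono) (use assms(2) in \<open>auto simp: defective_on_def\<close>)
  ultimately show ?thesis
    unfolding defective_chromatic_index_def by (intro Least_le) auto
qed

lemma (in multigraph) deg_in_le_max_degree: "deg_in G (edges G) v \<le> max_degree G"
proof (cases "v \<in> verts G")
  case True
  then have "degree G v \<le> Max (insert 0 (degree G ` verts G))"
    by (intro Max_ge) (use finite_verts in auto)
  then show ?thesis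
    by (simp only: max_degree_def degree_def deg_in_def)
next
  case False
  then have "{e \<in> edges G. v \<in> ends G e} = {}"
    using ends_subset by auto
  then show ?thesis
    by (simp only: deg_in_def card.empty)
qed

lemma (in multigraph) ex_odd_cycle:
  assumes "\<not> bipartite G"
  obtains vs es where "is_cycle G vs es" "odd (length es)"
proof -
  have "\<not> (\<forall>e\<in>edges G. \<forall>u w. ends G e = {u, w} \<longrightarrow> s u \<noteq> s w)" for s :: "'v \<Rightarrow> bool"
  proof
    assume s: "\<forall>e\<in>edges G. \<forall>u w. ends G e = {u, w} \<longrightarrow> s u \<noteq> s w"
    have sides: "\<exists>x\<in>{v \<in> verts G. s v}. \<exists>y\<in>{v \<in> verts G. \<not> s v}. ends G e = {x, y}" if e: "e \<in> edges G" for e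
    proof -
      obtain u w where uw: "ends G e = {u, w}"
        using card_ends[OF e] by (auto simp: card_2_iff)
      then have "s u \<noteq> s w" "u \<in> verts G" "w \<in> verts G" "ends G e = {w, u}"
        using s e ends_subset[OF e] by (auto simp: insert_commute)
      then show ?thesis
        using uw by (cases "s u") blast+
    qed
    have "bipartite G"
      unfolding bipartite_def
      by (intro exI[of _ "{v \<in> verts G. s v}"] exI[of _ "{v \<in> verts G. \<not> s v}"] conjI ballI sides) auto
    then show False
      using assms by simp
  qed
  then show ?thesis
    using two_coloring_or_odd_cycle[OF subset_refl] that by blast
qed

theorem theorem1p1:
  fixes G :: "('v, 'e) pre_multigraph" and d :: nat
  assumes "multigraph G"
    and "\<not> bipartite G"
    and "d \<ge> 1" and "odd d"
  shows "int (defective_chromatic_index d G)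
    \<le> \<lceil>(real (odd_girth G) * real (max_degree G) - 1) / (real d * real (odd_girth G) - 1)\<rceil>"
proof -
  interpret multigraph G by fact
  define g where "g = odd_girth G"
  define D where "D = max_degree G"
  let ?q = "(real g * real D - 1) / (real d * real g - 1)"
  let ?P = "\<lambda>n. odd n \<and> (\<exists>vs es. is_cycle G vs es \<and> length es = n)"
  obtain vs es where cycle: "is_cycle G vs es" "odd (length es)"
    using ex_odd_cycle assms(2) by blast
  then have "?P g"
    unfolding g_def odd_girth_def by (intro LeastI[of ?P "length es"]) blast
  then have g: "2 \<le> g"
    by (auto simp: is_cycle_def)
  have min: "g \<le> length es'" if "is_cycle G vs' es'" "odd (length es')" for vs' es'
    unfolding g_def odd_girth_def by (rule Least_le) (use that in blast)
  \<comment> \<open>This makes the numerator of \<open>?q\<close> positive, so that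
    \<open>nat\<close> does not truncate the ceiling in the choice of \<open>k\<close>.\<close>
  have "1 \<le> D"
  proof -
    have "0 < length es"
      using cycle(1) by (auto simp: is_cycle_def)
    then have "es ! 0 \<in> edges G" "vs ! 0 \<in> ends G (es ! 0)"
      using cycle(1) nth_mem[of 0 es] by (auto simp: is_cycle_def)
    then have "deg_in G (edges G) (vs ! 0) \<noteq> 0"
      using finite_edges by (auto simp: deg_in_def)
    then show ?thesis
      using deg_in_le_max_degree[of "vs ! 0"] by (simp add: D_def)
  qed
  have "1 * 2 \<le> real d * real g"
    by (rule mult_mono) (use g assms(3) in auto)
  then have den: "0 < real d * real g - 1"
    by simp
  have "2 * 1 \<le> real g * real D"
    by (rule mult_mono) (use g \<open>1 \<le> D\<close> in auto)
  then have "0 \<le> ?q"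
    using den by simp
  define k where "k = nat \<lceil>?q\<rceil>"
  have k: "int k = \<lceil>?q\<rceil>"
    using \<open>0 \<le> ?q\<close> by (simp add: k_def)
  then have "?q \<le> real k"
    by (metis le_of_int_ceiling of_int_of_nat_eq)
  then have "real g * real D - 1 \<le> real k * (real d * real g - 1)"
    using den by (simp add: pos_divide_le_eq)
  \<comment> \<open>Clearing the denominator turns the choice of \<open>k\<close> into the
    subtraction-free condition \<open>enough_colors\<close>, that is, g (k d - D) \<ge> k -
    1.\<close>
  then have "real (g * D + k) \<le> real (g * (k * d) + 1)"
    by (simp add: algebra_simps)
  then have "g * D + k \<le> g * (k * d) + 1"
    by (simp only: of_nat_le_iff)
  then obtain \<phi> where "defective_on G d k (edges G) \<phi>"
    using ex_defective_on[of D g d k] deg_in_le_max_degree min assms(3) g D_def by blast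
  then have "defective_chromatic_index d G \<le> k"
    using defective_chromatic_index_le assms(1) by blast
  then have "int (defective_chromatic_index d G) \<le> \<lceil>?q\<rceil>"
    using k by linarith
  then show ?thesis
    by (simp only: g_def D_def)
qed

end
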